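(* Let $n\geq 9$ and let $\mathcal{M}(n)$ be the number of sets $\{x_1,\dots,x_n\}$ of $n$ pairwise distinct positive integers with $\frac{1}{x_1}+\dots+\frac{1}{x_n}=1$ such that there is an odd prime $q$ with every $x_i$ of the form $2^{a_i}q^{b_i}$, $a_i\in\{0,1,2\}$, $b_i\geq 0$. Then $$\mathcal{M}(n)=tri(n)+sq(n)+ast(n)+dia(n)+St1(n)+St2(n)+St(n)+\begin{cases}2&\text{if $n$ is odd},\\ 1&\text{if $n$ is even},\end{cases}$$ where the integer sequences are those defined in the context.
   Context: Let $\delta_{n=k}$ equal $1$ if $n=k$ and $0$ otherwise. The integer sequences $tri,sq,ast,dia,St1,St2,St,t,p$, indexed by integers $n\geq 3$, are determined by the initial values $tri(3)=1$ and $dia(3)=sq(3)=ast(3)=St(3)=St2(3)=St1(3)=t(3)=p(3)=dia(4)=St(4)=St2(4)=St1(4)=t(4)=p(4)=St(5)=St2(5)=St1(5)=St2(6)=St(6)=St2(7)=St(7)=0$, together with the recurrences (valid for every $n$ whose value is not fixed by an initial value above): $ast(n)=ast(n-1)+dia(n-1)+\delta_{n=4}$; $tri(n)=tri(n-1)+sq(n-1)+St1(n-1)+St2(n-1)+St(n-1)$; $sq(n)=ast(n-1)+dia(n-1)$; $dia(n)=tri(n-2)+sq(n-2)+St1(n-2)+St2(n-2)+St(n-2)$; $St1(n)=ast(n-3)+dia(n-3)+\delta_{n=6}$; $St2(n)=ast(n-5)+dia(n-5)+t(n-5)+p(n-5)+\delta_{n=8}$; $St(n)=tri(n-5)+sq(n-5)+St1(n-5)+St2(n-5)+St(n-5)$;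 $t(n)=ast(n-2)+dia(n-2)+t(n-2)+p(n-2)+\delta_{n=5}$; $p(n)=tri(n-2)+sq(n-2)+St1(n-2)+St2(n-2)+St(n-2)$. Solutions are counted as unordered sets. *)

theory Defs
  imports Complex_Main "HOL-Computational_Algebra.Primes"
begin

text \<open>
  The sequences are indexed by integers at least 3; the values at indices 0, 1, 2 are
  irrelevant, since no recurrence below ever refers to them.
  The indicator of \<open>n = k\<close> is \<open>of_bool (n = k)\<close>. The first branch of each
  equation gives the initial values of that sequence.
\<close>

fun tri sq ast dia St1 St2 St t p :: "nat \<Rightarrow> int" where
  "tri n = (if n \<le> 3 then 1 else
     tri (n - 1) + sq (n - 1) + St1 (n - 1) + St2 (n - 1) + St (n - 1))"
| "sq n = (if n \<le> 3 then 0 else ast (n - 1) + dia (n - 1))"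
| "ast n = (if n \<le> 3 then 0 else ast (n - 1) + dia (n - 1) + of_bool (n = 4))"
| "dia n = (if n \<le> 4 then 0 else
     tri (n - 2) + sq (n - 2) + St1 (n - 2) + St2 (n - 2) + St (n - 2))"
| "St1 n = (if n \<le> 5 then 0 else ast (n - 3) + dia (n - 3) + of_bool (n = 6))"
| "St2 n = (if n \<le> 7 then 0 else
     ast (n - 5) + dia (n - 5) + t (n - 5) + p (n - 5) + of_bool (n = 8))"
| "St n = (if n \<le> 7 then 0 else
     tri (n - 5) + sq (n - 5) + St1 (n - 5) + St2 (n - 5) + St (n - 5))"
| "t n = (if n \<le> 4 then 0 else
     ast (n - 2) + dia (n - 2) + t (n - 2) + p (n - 2) + of_bool (n = 5))"
| "p n = (if n \<le> 4 then 0 else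
     tri (n - 2) + sq (n - 2) + St1 (n - 2) + St2 (n - 2) + St (n - 2))"

text \<open>The equations are recursive without constructor patterns and would make the
  simplifier loop.\<close>

declare tri.simps [simp del] sq.simps [simp del] ast.simps [simp del] dia.simps [simp del]
  St1.simps [simp del] St2.simps [simp del] St.simps [simp del] t.simps [simp del]
  p.simps [simp del]

definition egyptian_sets :: "nat \<Rightarrow> nat set set" where
  "egyptian_sets n =
     {X. finite X \<and> card X = n \<and> (\<forall>x\<in>X. 0 < x) \<and> (\<Sum>x\<in>X. 1 / (of_nat x :: rat)) = 1 \<and>
         (\<exists>q. prime q \<and> odd q \<and> (\<forall>x\<in>X. \<exists>a b. a \<in> {0, 1, 2} \<and> x = 2 ^ a * q ^ b))}"

definition \<M> :: "nat \<Rightarrow> nat" where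
  "\<M> n = card (egyptian_sets n)"

end

theory Submission
  imports Defs
begin

text \<open>
  Group the elements of a solution by their exponent of \<open>q\<close>. Dividing out the elements prime
  to \<open>q\<close>, which form a subset of \<open>{1, 2, 4}\<close>, and multiplying the remaining equation by \<open>q\<close>
  turns a representation of \<open>r / 4\<close> into one of \<open>q * (r - w) / 4\<close> with an integer
  \<open>0 \<le> w \<le> 7\<close>. Since all representable values are below \<open>7 * q / (4 * (q - 1))\<close>, only finitely
  many \<open>r\<close> occur: starting from \<open>r = 4\<close> one meets \<open>3, 6, 9\<close> for \<open>q = 3\<close>, only \<open>q\<close>
  itself for \<open>q = 5, 7\<close>, and nothing for larger \<open>q\<close>. For \<open>n \<ge> 5\<close> the prime 5 gives one
  solution, and the prime 7 gives one exactly if \<open>n\<close> is odd. For \<open>q = 3\<close> the number of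
  solutions and the sum of the seven sequences obey the same linear recurrence of order 6.
\<close>

section \<open>Finiteness of the families with a prescribed reciprocal sum\<close>

text \<open>The least of \<open>n\<close> positive integers with reciprocal sum \<open>s\<close> is
  at most \<open>n / s\<close>, so only finitely many choices exist for it; removing it gives the
  induction.\<close>

lemma finite_unit_fraction_sets:
  fixes s :: rat
  shows "finite {X. finite X \<and> card X = n \<and> (\<forall>x\<in>X. 0 < x) \<and> (\<Sum>x\<in>X. 1 / of_nat x) = s}"
    (is "finite (?F n s)")
proof (induction n arbitrary: s)
  case 0
  have "?F 0 s \<subseteq> {{}}" by auto
  then show ?case by (rule finite_subset) simp
next
  case (Suc n)
  define B where "B = nat \<lceil>of_nat (Suc n) / s\<rceil>"
  have "?F (Suc n) s \<subseteq> (\<Union>m\<in>{..B}. insert m ` ?F n (s - 1 / of_nat m))"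
  proof
    fix X assume "X \<in> ?F (Suc n) s"
    then have fin: "finite X" and card: "card X = Suc n" and pos: "\<forall>x\<in>X. 0 < x"
      and sum: "(\<Sum>x\<in>X. 1 / (of_nat x :: rat)) = s" by auto
    define m where "m = Min X"
    have ne: "X \<noteq> {}" using card by auto
    have mX: "m \<in> X" and mle: "\<And>x. x \<in> X \<Longrightarrow> m \<le> x" using fin ne by (auto simp: m_def)
    have mpos: "0 < m" using mX pos by auto
    have "s \<le> (\<Sum>x\<in>X. 1 / of_nat m)"
      unfolding sum[symmetric] by (rule sum_mono) (use mle mpos pos in \<open>auto intro!: divide_left_mono mult_pos_pos\<close>)
    then have s_le: "s \<le> of_nat (Suc n) / of_nat m" using card by simp
    have "0 < s" unfolding sum[symmetric] by (rule sum_pos) (use fin ne pos in auto)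
    then have "of_nat m \<le> of_nat (Suc n) / s" using s_le mpos by (simp add: field_simps)
    then have "m \<le> B" unfolding B_def by linarith
    moreover have "X - {m} \<in> ?F n (s - 1 / of_nat m)"
      using fin card pos sum mX by (auto simp: sum_diff1)
    moreover have "X = insert m (X - {m})" using mX by auto
    ultimately show "X \<in> (\<Union>m\<in>{..B}. insert m ` ?F n (s - 1 / of_nat m))" by blast
  qed
  then show ?case by (rule finite_subset) (use Suc in blast)
qed

section \<open>Representations of \<open>r / 4\<close>\<close>

definition smooth :: "nat \<Rightarrow> nat set" where
  "smooth q = {x. \<exists>a b. a \<in> {0, 1, 2} \<and> x = 2 ^ a * q ^ b}"

text \<open>The scaling by 4 makes every \<open>r\<close> met in the recursion an integer.\<close>

definition reps :: "nat \<Rightarrow> int \<Rightarrow> int \<Rightarrow> nat set set" where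
  "reps q r n = {X. finite X \<and> int (card X) = n \<and> X \<subseteq> smooth q \<and>
     (\<Sum>x\<in>X. 4 / (of_nat x :: rat)) = of_int r}"

lemma smooth_pos: "0 < q \<Longrightarrow> x \<in> smooth q \<Longrightarrow> 0 < x"
  by (auto simp: smooth_def)

lemma sum_4_over: "(\<Sum>x\<in>X. 4 / (of_nat x :: rat)) = 4 * (\<Sum>x\<in>X. 1 / of_nat x)"
  by (simp add: sum_distrib_left)

lemma finite_reps:
  assumes "0 < q"
  shows "finite (reps q r n)"
proof (rule finite_subset)
  show "reps q r n \<subseteq> {X. finite X \<and> card X = nat n \<and> (\<forall>x\<in>X. 0 < x) \<and>
      (\<Sum>x\<in>X. 1 / of_nat x) = (of_int r / 4 :: rat)}"
    using smooth_pos[OF assms] by (auto simp: reps_def sum_4_over)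
qed (rule finite_unit_fraction_sets)

lemma reps_zero: "0 < q \<Longrightarrow> reps q 0 n = (if n = 0 then {{}} else {})"
proof -
  assume q: "0 < q"
  have "X = {}" if "X \<in> reps q 0 n" for X
  proof (rule ccontr)
    assume "X \<noteq> {}"
    then have "0 < (\<Sum>x\<in>X. 4 / (of_nat x :: rat))"
      using that smooth_pos[OF q] by (intro sum_pos) (auto simp: reps_def)
    then show False using that by (simp add: reps_def)
  qed
  moreover have "{} \<in> reps q 0 n \<longleftrightarrow> n = 0" by (auto simp: reps_def)
  ultimately show ?thesis by (auto simp del: insert_iff)
qed

lemma reps_neg: "r < 0 \<Longrightarrow> reps q r n = {}"
proof -
  assume r: "r < 0"
  have "0 \<le> (\<Sum>x\<in>X. 4 / (of_nat x :: rat))" for X by (rule sum_nonneg) auto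
  moreover have "(of_int r :: rat) < 0" using r by simp
  ultimately show ?thesis unfolding reps_def by (metis (mono_tags, lifting) Collect_empty_eq not_less)
qed

lemma reps_card_le_0: "r \<noteq> 0 \<Longrightarrow> n \<le> 0 \<Longrightarrow> reps q r n = {}"
  by (auto simp: reps_def)

text \<open>A finite set lies in a finite grid of exponents, whose sum is 4 + 2 + 1 = 7 times a
  truncated geometric series in \<open>1 / q\<close>.\<close>

lemma sum_smooth_less:
  assumes q: "2 \<le> q" and X: "finite X" "X \<subseteq> smooth q"
  shows "(\<Sum>x\<in>X. 4 / (of_nat x :: rat)) < 7 * of_nat q / (of_nat q - 1)"
proof -
  define B where "B = Suc (Max X)"
  define I :: "(nat \<times> nat) set" where "I = {0, 1, 2} \<times> {..<B}"
  define f where "f = (\<lambda>(a, b). 2 ^ a * q ^ b :: nat)"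
  have "X \<subseteq> f ` I"
  proof
    fix x assume x: "x \<in> X"
    then obtain a b where ab: "a \<in> {0, 1, 2}" "x = 2 ^ a * q ^ b"
      using X unfolding smooth_def by blast
    have "b < q ^ b" using q by (intro power_gt_expt) auto
    also have "\<dots> \<le> x" using ab by simp
    also have "\<dots> \<le> Max X" using X x by simp
    finally show "x \<in> f ` I" using ab by (auto simp: I_def f_def B_def intro!: image_eqI[of _ _ "(a, b)"])
  qed
  then have "(\<Sum>x\<in>X. 4 / (of_nat x :: rat)) \<le> (\<Sum>x\<in>f ` I. 4 / of_nat x)"
    by (intro sum_mono2) (auto simp: I_def)
  \<comment> \<open>Only an inequality: \<open>f\<close> may fail to be injective, as for
    \<open>q = 2\<close>.\<close>
  also have "\<dots> \<le> (\<Sum>i\<in>I. 4 / of_nat (f i))"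
    using sum_image_le[of I "\<lambda>x. 4 / (of_nat x :: rat)" f] by (simp add: I_def o_def)
  also have "\<dots> = (\<Sum>a\<in>{0, 1, 2::nat}. \<Sum>b<B. 4 / (2 ^ a * of_nat q ^ b))"
    unfolding I_def f_def by (subst sum.cartesian_product) (auto intro!: sum.cong)
  also have "\<dots> = (\<Sum>b<B. 7 * (1 / of_nat q) ^ b)"
    by (simp add: sum.distrib[symmetric] power_one_over field_simps)
  also have "\<dots> = 7 * ((1 - (1 / of_nat q) ^ B) / (1 - 1 / of_nat q))"
    unfolding sum_distrib_left[symmetric] using q by (subst sum_gp_strict) auto
  also have "\<dots> < 7 * (1 / (1 - 1 / of_nat q))"
    using q by (intro mult_strict_left_mono divide_strict_right_mono) (auto simp: field_simps)
  also have "\<dots> = 7 * of_nat q / (of_nat q - 1)" using q by (simp add: field_simps)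
  finally show ?thesis .
qed

text \<open>Clearing the denominator \<open>q - 1\<close> leaves an integer condition that is
  decided by evaluation for concrete \<open>q\<close> and \<open>r\<close>.\<close>

lemma reps_large:
  assumes "2 \<le> q" "r * (int q - 1) \<ge> 7 * int q"
  shows "reps q r n = {}"
proof -
  have "of_int (r * (int q - 1)) \<ge> (of_int (7 * int q) :: rat)" using assms(2) of_int_le_iff by blast
  then have "7 * of_nat q / (of_nat q - 1) \<le> (of_int r :: rat)"
    using assms(1) by (simp add: field_simps)
  then show ?thesis using sum_smooth_less[OF assms(1)] unfolding reps_def by fastforce
qed

lemma smooth_eq:
  "smooth q = {1, 2, 4} \<union> (*) q ` smooth q"
proof (intro equalityI subsetI)
  fix x assume "x \<in> smooth q"
  then obtain a b where ab: "a \<in> {0, 1, 2}" "x = 2 ^ a * q ^ b" by (auto simp: smooth_def)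
  show "x \<in> {1, 2, 4} \<union> (*) q ` smooth q"
  proof (cases b)
    case 0
    then show ?thesis using ab by auto
  next
    case (Suc c)
    then have "x = q * (2 ^ a * q ^ c)" "2 ^ a * q ^ c \<in> smooth q" using ab by (auto simp: smooth_def)
    then show ?thesis by blast
  qed
next
  fix x assume "x \<in> {1, 2, 4} \<union> (*) q ` smooth q"
  then consider "x = 2 ^ 0 * q ^ 0" | "x = 2 ^ 1 * q ^ 0" | "x = 2 ^ 2 * q ^ 0"
    | a b where "a \<in> {0, 1, 2}" "x = 2 ^ a * q ^ Suc b"
  proof (cases "x \<in> {1, 2, 4}")
    case True
    then show ?thesis using that(1-3) by auto
  next
    case False
    then obtain a b where "a \<in> {0, 1, 2}" "x = q * (2 ^ a * q ^ b)"
      using \<open>x \<in> _\<close> unfolding smooth_def by blast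
    then show ?thesis using that(4)[of a b] by (simp add: mult.left_commute)
  qed
  then show "x \<in> smooth q" unfolding smooth_def by cases blast+
qed

text \<open>On subsets of \<open>{1, 2, 4}\<close> the division is exact, and the eight subsets have
  the weights 0 to 7, each once.\<close>

definition weight :: "nat set \<Rightarrow> int" where
  "weight K = (\<Sum>x\<in>K. int (4 div x))"

lemma of_int_weight:
  assumes "K \<subseteq> {1, 2, 4}"
  shows "of_int (weight K) = (\<Sum>x\<in>K. 4 / (of_nat x :: rat))"
  unfolding weight_def of_int_sum by (rule sum.cong) (use assms in auto)

text \<open>Lets the simplifier expand a sum over \<open>Pow {1, 2, 4}\<close> into its eight
  terms.\<close>

lemma sum_Pow_insert:
  assumes "finite A" "a \<notin> A"
  shows "sum f (Pow (insert a A)) = (\<Sum>K\<in>Pow A. f K) + (\<Sum>K\<in>Pow A. f (insert a K))"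
proof -
  have "inj_on (insert a) (Pow A)" using assms by (auto simp: inj_on_def)
  moreover have "Pow A \<inter> insert a ` Pow A = {}" using assms by auto
  ultimately show ?thesis using assms by (simp add: Pow_insert sum.union_disjoint sum.reindex)
qed

text \<open>Integer values and sizes make all subtractions in the recurrences exact; there is
  nothing of negative size.\<close>

definition num_reps :: "nat \<Rightarrow> int \<Rightarrow> int \<Rightarrow> int" where
  "num_reps q r n = int (card (reps q r n))"

lemma num_reps_zero: "0 < q \<Longrightarrow> num_reps q 0 n = of_bool (n = 0)"
  by (simp add: num_reps_def reps_zero)

lemma num_reps_neg: "r < 0 \<Longrightarrow> num_reps q r n = 0"
  by (simp add: num_reps_def reps_neg)

lemma num_reps_card_le_0: "r \<noteq> 0 \<Longrightarrow> n \<le> 0 \<Longrightarrow> num_reps q r n = 0"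
  by (simp add: num_reps_def reps_card_le_0)

lemma num_reps_large: "2 \<le> q \<Longrightarrow> r * (int q - 1) \<ge> 7 * int q \<Longrightarrow> num_reps q r n = 0"
  by (simp add: num_reps_def reps_large)

section \<open>The recursion obtained by dividing by \<open>q\<close>\<close>

context
  fixes q :: nat
  assumes q: "odd q" "3 \<le> q"
begin

text \<open>The multiples of \<open>q\<close> are 0, the odd number \<open>q \<ge> 3\<close>, and
  numbers from 6 on.\<close>

lemma join_disjoint: "K \<subseteq> {1, 2, 4} \<Longrightarrow> K \<inter> (*) q ` Y = {}"
proof -
  have "q * y \<notin> {1, 2, 4}" for y
  proof
    assume a: "q * y \<in> {1, 2, 4}"
    then have "y \<noteq> 0" by (cases "y = 0") auto
    moreover have "\<not> q * y = 4" if "y = 1" using that q by auto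
    moreover have "6 \<le> q * y" if "2 \<le> y" using mult_le_mono[OF q(2) that] by simp
    ultimately show False using a q by (cases "y \<le> 1") (auto simp: le_Suc_eq)
  qed
  then show "K \<subseteq> {1, 2, 4} \<Longrightarrow> ?thesis" by blast
qed

lemma inj_mult_q: "inj_on ((*) q) Y"
  using q by (auto simp: inj_on_def)

text \<open>Multiplying the elements of \<open>Y\<close> by \<open>q\<close> divides their sum
  \<open>s\<close> by \<open>q\<close>, and \<open>w + s / q = r\<close> is solved by
  \<open>s = q * (r - w)\<close>.\<close>

lemma join_in_reps:
  assumes K: "K \<subseteq> {1, 2, 4}" and Y: "Y \<subseteq> smooth q"
  shows "K \<union> (*) q ` Y \<in> reps q r n \<longleftrightarrow> Y \<in> reps q (int q * (r - weight K)) (n - int (card K))"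
proof -
  have finK: "finite K" using K by (rule finite_subset) simp
  have fin: "finite (K \<union> (*) q ` Y) \<longleftrightarrow> finite Y"
    using finK inj_mult_q by (simp add: finite_image_iff)
  have card: "card (K \<union> (*) q ` Y) = card K + card Y" if "finite Y"
    using that finK join_disjoint[OF K] card_image[OF inj_mult_q] by (simp add: card_Un_disjoint)
  have sub: "K \<union> (*) q ` Y \<subseteq> smooth q" using K Y smooth_eq[of q] by blast
  have "(\<Sum>x\<in>K \<union> (*) q ` Y. 4 / (of_nat x :: rat)) = of_int (weight K) + (\<Sum>y\<in>Y. 4 / of_nat y) / of_nat q"
    if "finite Y"
    using that finK join_disjoint[OF K]
    by (simp add: sum.union_disjoint of_int_weight[OF K] sum.reindex[OF inj_mult_q] sum_divide_distrib)
      (simp add: mult.commute)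
  moreover have "of_int w + s / of_nat q = (of_int r :: rat) \<longleftrightarrow> s = of_int (int q * (r - w))" for w and s :: rat
    using q by (auto simp: field_simps)
  ultimately show ?thesis using fin card sub Y q unfolding reps_def by (auto simp: algebra_simps)
qed

lemma reps_eq_UN:
  "reps q r n = (\<Union>K\<in>Pow {1, 2, 4}.
     (\<lambda>Y. K \<union> (*) q ` Y) ` reps q (int q * (r - weight K)) (n - int (card K)))" (is "_ = ?R")
proof (intro equalityI subsetI)
  fix X assume X: "X \<in> reps q r n"
  define K where "K = X \<inter> {1, 2, 4}"
  define Y where "Y = {y \<in> smooth q. q * y \<in> X}"
  have "X = K \<union> (*) q ` Y" using X smooth_eq[of q] unfolding reps_def K_def Y_def by blast
  moreover have "K \<in> Pow {1, 2, 4}" "Y \<subseteq> smooth q" by (auto simp: K_def Y_def)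
  ultimately show "X \<in> ?R" using X join_in_reps[of K Y r n] by auto
next
  fix X assume "X \<in> ?R"
  then obtain K Y where "K \<subseteq> {1, 2, 4}" "X = K \<union> (*) q ` Y"
    "Y \<in> reps q (int q * (r - weight K)) (n - int (card K))" by auto
  then show "X \<in> reps q r n" using join_in_reps[of K Y r n] by (auto simp: reps_def)
qed

text \<open>Intersecting with \<open>{1, 2, 4}\<close> recovers \<open>K\<close>; the complement is
  the injective image of \<open>Y\<close>.\<close>

lemma join_inject:
  assumes "K \<subseteq> {1, 2, 4}" "K' \<subseteq> {1, 2, 4}" "K \<union> (*) q ` Y = K' \<union> (*) q ` Y'"
  shows "K = K' \<and> Y = Y'"
proof -
  have split: "L = (L \<union> (*) q ` Z) \<inter> {1, 2, 4}" "(*) q ` Z = (L \<union> (*) q ` Z) - {1, 2, 4}"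
    if "L \<subseteq> {1, 2, 4}" for L Z
    using that join_disjoint[OF subset_refl, of Z] by blast+
  have "K = K'" using split(1)[OF assms(1), of Y] split(1)[OF assms(2), of Y'] assms(3) by metis
  moreover have "(*) q ` Y = (*) q ` Y'"
    using split(2)[OF assms(1), of Y] split(2)[OF assms(2), of Y'] assms(3) by metis
  then have "Y = Y'" using inj_image_eq_iff[OF inj_mult_q] by blast
  ultimately show ?thesis by blast
qed

lemma card_reps_rec:
  "card (reps q r n) =
     (\<Sum>K\<in>Pow {1, 2, 4}. card (reps q (int q * (r - weight K)) (n - int (card K))))"
proof -
  let ?R = "\<lambda>K. reps q (int q * (r - weight K)) (n - int (card K))"
  let ?J = "\<lambda>K Y. K \<union> (*) q ` Y"
  have "card (reps q r n) = (\<Sum>K\<in>Pow {1, 2, 4}. card (?J K ` ?R K))"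
    unfolding reps_eq_UN[of r n]
  proof (rule card_UN_disjoint)
    show "\<forall>K\<in>Pow {1, 2, 4}. finite (?J K ` ?R K)" using finite_reps q by auto
    show "\<forall>K\<in>Pow {1, 2, 4}. \<forall>K'\<in>Pow {1, 2, 4}. K \<noteq> K' \<longrightarrow> ?J K ` ?R K \<inter> ?J K' ` ?R K' = {}"
    proof (intro ballI impI equals0I)
      fix K K' X
      assume K: "K \<in> Pow {1, 2, 4}" "K' \<in> Pow {1, 2, 4}" "K \<noteq> K'"
        and "X \<in> ?J K ` ?R K \<inter> ?J K' ` ?R K'"
      then obtain Y Y' where "?J K Y = ?J K' Y'" by auto
      then show False using join_inject[of K K' Y Y'] K by simp
    qed
  qed simp
  also have "\<dots> = (\<Sum>K\<in>Pow {1, 2, 4}. card (?R K))"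
    by (rule sum.cong[OF refl], rule card_image) (meson join_inject inj_onI PowD)
  finally show ?thesis .
qed

text \<open>One term per subset of \<open>{1, 2, 4}\<close>: \<open>r\<close> drops by its weight,
  \<open>n\<close> by the number of binary ones of that weight.\<close>

lemma num_reps_rec:
  "num_reps q r n = num_reps q (int q * r) n
     + num_reps q (int q * (r - 1)) (n - 1) + num_reps q (int q * (r - 2)) (n - 1)
     + num_reps q (int q * (r - 3)) (n - 2) + num_reps q (int q * (r - 4)) (n - 1)
     + num_reps q (int q * (r - 5)) (n - 2) + num_reps q (int q * (r - 6)) (n - 2)
     + num_reps q (int q * (r - 7)) (n - 3)"
  unfolding num_reps_def card_reps_rec[of r n] by (simp add: sum_Pow_insert weight_def)

end

section \<open>Counting for each prime\<close>

text \<open>Values are below 7 * 3 / 2 = 10.5, so of the multiples of 3 only 0, 3, 6, 9 survive; the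
  value 0 yields the indicators.\<close>

lemma num_reps_3:
  "num_reps 3 4 n = num_reps 3 9 (n - 1) + num_reps 3 6 (n - 1) + num_reps 3 3 (n - 2) + of_bool (n = 1)"
  "num_reps 3 3 n = num_reps 3 9 n + num_reps 3 6 (n - 1) + num_reps 3 3 (n - 1) + of_bool (n = 2)"
  "num_reps 3 6 n = num_reps 3 9 (n - 2) + num_reps 3 6 (n - 1) + num_reps 3 3 (n - 2) + of_bool (n = 2)"
  "num_reps 3 9 n = num_reps 3 9 (n - 2) + num_reps 3 6 (n - 3)"
  using num_reps_rec[of 3 4 n] num_reps_rec[of 3 3 n] num_reps_rec[of 3 6 n] num_reps_rec[of 3 9 n]
  by (simp_all add: num_reps_zero num_reps_neg num_reps_large)

text \<open>The bound 35 / 4 leaves only the multiples 0 and 5.\<close>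

lemma num_reps_5:
  "num_reps 5 4 n = num_reps 5 5 (n - 2) + of_bool (n = 1)"
  "num_reps 5 5 n = num_reps 5 5 (n - 1) + of_bool (n = 2)"
  using num_reps_rec[of 5 4 n] num_reps_rec[of 5 5 n]
  by (simp_all add: num_reps_zero num_reps_neg num_reps_large)

text \<open>The bound 49 / 6 leaves only the multiples 0 and 7.\<close>

lemma num_reps_7:
  "num_reps 7 4 n = num_reps 7 7 (n - 2) + of_bool (n = 1)"
  "num_reps 7 7 n = num_reps 7 7 (n - 2) + of_bool (n = 3)"
  using num_reps_rec[of 7 4 n] num_reps_rec[of 7 7 n]
  by (simp_all add: num_reps_zero num_reps_neg num_reps_large)

text \<open>Here \<open>7 * q / (q - 1) \<le> q\<close>, so every positive multiple of
  \<open>q\<close> is too large; what remains is the set \<open>{1}\<close>, of weight 4.\<close>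

lemma num_reps_ge_9:
  assumes "odd q" "9 \<le> q"
  shows "num_reps q 4 n = of_bool (n = 1)"
proof -
  have "num_reps q (int q * k) m = 0" if "1 \<le> k" for k m
  proof (rule num_reps_large)
    have "7 * int q \<le> 1 * int q * (int q - 1)" using assms by (simp add: algebra_simps)
    also have "\<dots> \<le> k * int q * (int q - 1)" using assms that by (intro mult_right_mono) auto
    finally show "7 * int q \<le> int q * k * (int q - 1)" by (simp add: mult.commute)
  qed (use assms in auto)
  from this[of 1] this[of 2] this[of 3] this[of 4] show ?thesis
    using num_reps_rec[of q 4 n] assms by (simp add: num_reps_zero num_reps_neg mult_pos_neg)
qed

text \<open>The subset \<open>{1}\<close> reproduces the value 5 and adds one element;
  \<open>{1, 4}\<close> of weight 5 ends the chain.\<close>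

lemma num_reps_5_eq_1: "num_reps 5 5 (int n + 2) = 1"
proof (induction n)
  case 0
  then show ?case using num_reps_5(2)[of 2] by (simp add: num_reps_5(2)[of 1] num_reps_card_le_0)
next
  case (Suc n)
  then show ?case using num_reps_5(2)[of "int n + 3"] by (simp add: algebra_simps)
qed

text \<open>The subset \<open>{1, 2}\<close> reproduces the value 7 and adds two elements, and
  \<open>{1, 2, 4}\<close> ends the chain, whence the parity.\<close>

lemma num_reps_7_eq: "num_reps 7 7 (int n) = of_bool (odd n \<and> 3 \<le> n)"
proof (induction n rule: less_induct)
  case (less n)
  show ?case
  proof (cases "n \<le> 2")
    case True
    then have "n = 0 \<or> n = 1 \<or> n = 2" by auto
    then show ?thesis using num_reps_7(2)[of "int n"] by (auto simp: num_reps_card_le_0)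
  next
    case False
    then have "num_reps 7 7 (int n - 2) = of_bool (odd (n - 2) \<and> 3 \<le> n - 2)"
      using less[of "n - 2"] by (simp add: of_nat_diff)
    moreover have "odd (n - 2) = odd n" using False by simp
    ultimately show ?thesis using False num_reps_7(2)[of "int n"]
      by (cases "n = 3"; cases "n = 4") auto
  qed
qed

text \<open>In the shift operator \<open>x\<close>, the system for the values 3, 6, 9 has
  determinant \<open>1 - 2*x + x^3 - x^4 - x^5 + x^6\<close> up to sign. For
  \<open>n \<ge> 10\<close> all indices used are at least 3, where the indicators vanish.\<close>

lemma num_reps_3_order_6:
  assumes "10 \<le> n"
  shows "num_reps 3 4 n = 2 * num_reps 3 4 (n - 1) - num_reps 3 4 (n - 3) + num_reps 3 4 (n - 4)
    + num_reps 3 4 (n - 5) - num_reps 3 4 (n - 6)"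
proof -
  have a: "num_reps 3 4 (n - k) = num_reps 3 9 (n - (k + 1)) + num_reps 3 6 (n - (k + 1))
      + num_reps 3 3 (n - (k + 2))" if "k \<le> 6" for k
    using that assms num_reps_3(1)[of "n - k"] by (simp add: diff_diff_add add.commute)
  have r: "num_reps 3 3 (n - k) = num_reps 3 9 (n - k) + num_reps 3 6 (n - (k + 1))
      + num_reps 3 3 (n - (k + 1))"
    "num_reps 3 6 (n - k) = num_reps 3 9 (n - (k + 2)) + num_reps 3 6 (n - (k + 1))
      + num_reps 3 3 (n - (k + 2))" if "k \<le> 7" for k
    using that assms num_reps_3(2,3)[of "n - k"] by (simp_all add: diff_diff_add add.commute)
  have p: "num_reps 3 9 (n - k) = num_reps 3 9 (n - (k + 2)) + num_reps 3 6 (n - (k + 3))" for k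
    using num_reps_3(4)[of "n - k"] by (simp add: diff_diff_add add.commute)
  note a[of 0, simplified] a[of 1, simplified] a[of 3, simplified] a[of 4, simplified]
    a[of 5, simplified] a[of 6, simplified]
  moreover note r[of 1, simplified] r[of 2, simplified] r[of 3, simplified] r[of 4, simplified]
    r[of 5, simplified] r[of 6, simplified] r[of 7, simplified]
  moreover note p[of 1, simplified] p[of 2, simplified] p[of 3, simplified] p[of 4, simplified]
    p[of 5, simplified] p[of 6, simplified] p[of 7, simplified]
  ultimately show ?thesis by linarith
qed

lemma num_reps_3_initial:
  "num_reps 3 4 9 = 52" "num_reps 3 4 10 = 100" "num_reps 3 4 11 = 190"
  "num_reps 3 4 12 = 362" "num_reps 3 4 13 = 690" "num_reps 3 4 14 = 1314"
proof -
  \<comment> \<open>Without the guard \<open>0 < n\<close> these equations would make the simplifier loop.\<close>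
  have step: "num_reps 3 3 n = num_reps 3 9 n + num_reps 3 6 (n - 1) + num_reps 3 3 (n - 1) + of_bool (n = 2)"
    "num_reps 3 6 n = num_reps 3 9 (n - 2) + num_reps 3 6 (n - 1) + num_reps 3 3 (n - 2) + of_bool (n = 2)"
    "num_reps 3 9 n = num_reps 3 9 (n - 2) + num_reps 3 6 (n - 3)" if "0 < n" for n
    by (rule num_reps_3)+
  \<comment> \<open>The recurrence of order 6 first applies at size 10 and reaches back to size
    4.\<close>
  have a: "num_reps 3 4 4 = 2" "num_reps 3 4 5 = 4" "num_reps 3 4 6 = 8" "num_reps 3 4 7 = 14"
    "num_reps 3 4 8 = 28" and 9: "num_reps 3 4 9 = 52"
    by (simp_all add: num_reps_3(1) step num_reps_card_le_0)
  show "num_reps 3 4 9 = 52" by (fact 9)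
  show 10: "num_reps 3 4 10 = 100" using num_reps_3_order_6[of 10] a 9 by simp
  show 11: "num_reps 3 4 11 = 190" using num_reps_3_order_6[of 11] a 9 10 by simp
  show 12: "num_reps 3 4 12 = 362" using num_reps_3_order_6[of 12] a 9 10 11 by simp
  show 13: "num_reps 3 4 13 = 690" using num_reps_3_order_6[of 13] a 9 10 11 12 by simp
  show "num_reps 3 4 14 = 1314" using num_reps_3_order_6[of 14] a 9 10 11 12 13 by simp
qed

section \<open>The sequences of the statement\<close>

text \<open>All nine recurrences see the sequences only through the groups \<open>U\<close>,
  \<open>V\<close>, \<open>W\<close>; the theorem is about \<open>U + V\<close>.\<close>

definition U :: "nat \<Rightarrow> int" where "U n = tri n + sq n + St1 n + St2 n + St n"
definition V :: "nat \<Rightarrow> int" where "V n = ast n + dia n"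
definition W :: "nat \<Rightarrow> int" where "W n = t n + p n"

text \<open>The bounds here and for \<open>V\<close> and \<open>W\<close> lie just past the last
  indicators, at 8, 4 and 5 respectively.\<close>

lemma U_rec: "9 \<le> n \<Longrightarrow> U n = U (n - 1) + U (n - 5) + V (n - 1) + V (n - 3) + V (n - 5) + W (n - 5)"
  using tri.simps[of n] sq.simps[of n] St1.simps[of n] St2.simps[of n] St.simps[of n]
  by (simp add: U_def V_def W_def)

lemma V_rec: "5 \<le> n \<Longrightarrow> V n = V (n - 1) + U (n - 2)"
  using ast.simps[of n] dia.simps[of n] by (simp add: U_def V_def)

lemma W_rec: "6 \<le> n \<Longrightarrow> W n = V (n - 2) + W (n - 2) + U (n - 2)"
  using t.simps[of n] p.simps[of n] by (simp add: U_def V_def W_def)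

text \<open>Five consecutive indices determine everything from 9 on, as no lag exceeds 5.\<close>

lemma UVW_initial:
  "U 4 = 1" "U 5 = 2" "U 6 = 5" "U 7 = 9" "U 8 = 18"
  "V 4 = 1" "V 5 = 2" "V 6 = 3" "V 7 = 5" "V 8 = 10"
  "W 4 = 0" "W 5 = 2" "W 6 = 2" "W 7 = 6" "W 8 = 10"
  by code_simp+

lemma UV_initial:
  "U 9 + V 9 = 52" "U 10 + V 10 = 100" "U 11 + V 11 = 190"
  "U 12 + V 12 = 362" "U 13 + V 13 = 690" "U 14 + V 14 = 1314"
proof -
  have 9: "U 9 = 33" "V 9 = 19" "W 9 = 20"
    using U_rec[of 9] V_rec[of 9] W_rec[of 9] by (simp_all add: UVW_initial)
  have 10: "U 10 = 63" "V 10 = 37" "W 10 = 38"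
    using U_rec[of 10] V_rec[of 10] W_rec[of 10] by (simp_all add: UVW_initial 9)
  have 11: "U 11 = 120" "V 11 = 70" "W 11 = 72"
    using U_rec[of 11] V_rec[of 11] W_rec[of 11] by (simp_all add: UVW_initial 9 10)
  have 12: "U 12 = 229" "V 12 = 133" "W 12 = 138"
    using U_rec[of 12] V_rec[of 12] W_rec[of 12] by (simp_all add: UVW_initial 9 10 11)
  have 13: "U 13 = 437" "V 13 = 253" "W 13 = 262"
    using U_rec[of 13] V_rec[of 13] W_rec[of 13] by (simp_all add: UVW_initial 9 10 11 12)
  have 14: "U 14 = 832" "V 14 = 482"
    using U_rec[of 14] V_rec[of 14] by (simp_all add: UVW_initial 9 10 11 12 13)
  show "U 9 + V 9 = 52" "U 10 + V 10 = 100" "U 11 + V 11 = 190"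
    "U 12 + V 12 = 362" "U 13 + V 13 = 690" "U 14 + V 14 = 1314"
    by (simp_all add: 9 10 11 12 13 14)
qed

text \<open>Eliminating \<open>W\<close> and separating out \<open>U + V\<close> works because the
  system for \<open>U\<close>, \<open>V\<close>, \<open>W\<close> has the same determinant as the
  one for \<open>q = 3\<close>.\<close>

lemma UV_order_6:
  assumes "15 \<le> n"
  defines "a \<equiv> \<lambda>n. U n + V n"
  shows "a n = 2 * a (n - 1) - a (n - 3) + a (n - 4) + a (n - 5) - a (n - 6)"
proof -
  \<comment> \<open>Additive indices avoid truncated subtraction on naturals.\<close>
  obtain m where n: "n = m + 15" using assms(1) by (metis add.commute le_Suc_ex)
  have r: "U (m + (k + 9)) = U (m + (k + 8)) + U (m + (k + 4)) + V (m + (k + 8)) + V (m + (k + 6))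
      + V (m + (k + 4)) + W (m + (k + 4))"
    "V (m + (k + 9)) = V (m + (k + 8)) + U (m + (k + 7))"
    "W (m + (k + 6)) = V (m + (k + 4)) + W (m + (k + 4)) + U (m + (k + 4))" for k
    using U_rec[of "m + (k + 9)"] V_rec[of "m + (k + 9)"] W_rec[of "m + (k + 6)"]
    by (simp_all add: ac_simps)
  note r(1)[of 2, simplified] r(1)[of 3, simplified] r(1)[of 5, simplified] r(1)[of 6, simplified]
    r(2)[of 1, simplified] r(2)[of 3, simplified] r(2)[of 4, simplified] r(2)[of 6, simplified]
    r(3)[of 2, simplified] r(3)[of 3, simplified] r(3)[of 4, simplified]
  then have "a (m + 15) = 2 * a (m + 14) - a (m + 12) + a (m + 11) + a (m + 10) - a (m + 9)"
    unfolding a_def by algebra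
  moreover have "n - 1 = m + 14" "n - 3 = m + 12" "n - 4 = m + 11" "n - 5 = m + 10" "n - 6 = m + 9"
    by (simp_all add: n)
  ultimately show ?thesis by (simp only: n)
qed

lemma num_reps_3_eq_UV:
  assumes "9 \<le> n"
  shows "num_reps 3 4 (int n) = U n + V n"
  using assms
proof (induction n rule: less_induct)
  case (less n)
  show ?case
  proof (cases "15 \<le> n")
    case True
    \<comment> \<open>From 15 on, even \<open>n - 6\<close> is in the range of the induction
      hypothesis.\<close>
    have "num_reps 3 4 (int n - int k) = U (n - k) + V (n - k)" if "1 \<le> k" "k \<le> 6" for k
      using less.IH[of "n - k"] True that by (simp add: of_nat_diff)
    from this[of 1] this[of 3] this[of 4] this[of 5] this[of 6] show ?thesis
      using num_reps_3_order_6[of "int n"] UV_order_6[OF True] True by simp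
  next
    case False
    with less.prems have "n \<in> {9, 10, 11, 12, 13, 14}" by auto
    then show ?thesis using num_reps_3_initial UV_initial by auto
  qed
qed

section \<open>Combining the primes\<close>

text \<open>A positive exponent of \<open>q\<close> would make \<open>q\<close> divide 2 or
  \<open>q'\<close>.\<close>

lemma smooth_Int:
  assumes "prime q" "prime q'" "odd q" "odd q'" "q \<noteq> q'"
  shows "smooth q \<inter> smooth q' \<subseteq> {1, 2, 4}"
proof
  fix x assume "x \<in> smooth q \<inter> smooth q'"
  then obtain a b c d where x: "a \<in> {0, 1, 2}" "x = 2 ^ a * q ^ b" "x = 2 ^ c * q' ^ d"
    unfolding smooth_def by blast
  have "b = 0"
  proof (rule ccontr)
    assume "b \<noteq> 0"
    then have "q dvd 2 ^ c * q' ^ d" using x by (metis dvd_mult dvd_power neq0_conv)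
    then have "q dvd 2 \<or> q dvd q'" using assms(1) prime_dvd_mult_iff prime_dvd_power by blast
    then show False
      using assms primes_dvd_imp_eq two_is_prime_nat by (metis even_numeral)
  qed
  then show "x \<in> {1, 2, 4}" using x by auto
qed

text \<open>A common solution would lie in \<open>{1, 2, 4}\<close>, which has fewer than four
  elements.\<close>

lemma reps_disjoint:
  assumes "prime q" "prime q'" "odd q" "odd q'" "q \<noteq> q'" "4 \<le> n"
  shows "reps q r n \<inter> reps q' r' n = {}"
proof (rule equals0I)
  fix X assume "X \<in> reps q r n \<inter> reps q' r' n"
  then have "X \<subseteq> {1, 2, 4}" "int (card X) = n"
    using smooth_Int[OF assms(1-5)] by (auto simp: reps_def)
  then show False using card_mono[of "{1, 2, 4}" X] assms(6) by simp
qed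

lemma egyptian_sets_eq:
  "egyptian_sets n = (\<Union>q\<in>{q. prime q \<and> odd q}. reps q 4 (int n))"
proof (intro equalityI subsetI)
  fix X assume "X \<in> egyptian_sets n"
  then obtain q where "prime q" "odd q" "X \<in> reps q 4 (int n)"
    unfolding egyptian_sets_def reps_def smooth_def sum_4_over mem_Collect_eq subset_iff
    by (metis mult.right_neutral of_int_numeral)
  then show "X \<in> (\<Union>q\<in>{q. prime q \<and> odd q}. reps q 4 (int n))" by auto
next
  fix X assume "X \<in> (\<Union>q\<in>{q. prime q \<and> odd q}. reps q 4 (int n))"
  then obtain q where q: "prime q" "odd q" "X \<in> reps q 4 (int n)" by auto
  then have "\<forall>x\<in>X. 0 < x" using smooth_pos[of q] prime_gt_0_nat[of q] by (auto simp: reps_def)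
  then show "X \<in> egyptian_sets n"
    using q unfolding egyptian_sets_def reps_def smooth_def sum_4_over by auto
qed

text \<open>Size at least 2 excludes \<open>{1}\<close>, the only solution for primes from 9
  on.\<close>

lemma egyptian_sets_eq_357:
  assumes "2 \<le> n"
  shows "egyptian_sets n = reps 3 4 (int n) \<union> reps 5 4 (int n) \<union> reps 7 4 (int n)"
proof -
  have "reps q 4 (int n) = {}" if q: "prime q" "odd q" "q \<notin> {3, 5, 7}" for q
  proof -
    have "9 \<le> q"
    proof (rule ccontr)
      assume "\<not> 9 \<le> q"
      then have "q = 0 \<or> q = 1 \<or> q = 2 \<or> q = 3 \<or> q = 4 \<or> q = 5 \<or> q = 6 \<or> q = 7 \<or> q = 8"
        by auto
      then show False using q by auto
    qed
    then have "num_reps q 4 (int n) = 0" using num_reps_ge_9[of q "int n"] q assms by simp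
    then show ?thesis using finite_reps[of q 4 "int n"] \<open>9 \<le> q\<close> by (simp add: num_reps_def)
  qed
  moreover have "{3, 5, 7} \<subseteq> {q::nat. prime q \<and> odd q}" by simp
  ultimately show ?thesis unfolding egyptian_sets_eq by blast
qed

theorem theorem2:
  fixes n :: nat
  assumes "n \<ge> 9"
  shows "int (\<M> n) =
    tri n + sq n + ast n + dia n + St1 n + St2 n + St n + (if odd n then 2 else 1)"
proof -
  have primes: "prime (3::nat)" "prime (5::nat)" "prime (7::nat)" by simp_all
  have "int (\<M> n) = num_reps 3 4 (int n) + num_reps 5 4 (int n) + num_reps 7 4 (int n)"
    unfolding \<M>_def num_reps_def
    using assms primes egyptian_sets_eq_357[of n] reps_disjoint[of 3 5 "int n" 4 4]
      reps_disjoint[of 3 7 "int n" 4 4] reps_disjoint[of 5 7 "int n" 4 4]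
    by (simp add: card_Un_disjoint finite_reps Int_Un_distrib2)
  \<comment> \<open>The count for value 4 is that for value 5 at size
    \<open>n - 2 = (n - 4) + 2\<close>.\<close>
  moreover have "num_reps 5 4 (int n) = 1"
    using num_reps_5_eq_1[of "n - 4"] num_reps_5(1)[of "int n"] assms by (simp add: of_nat_diff)
  moreover have "num_reps 7 4 (int n) = of_bool (odd n)"
    using num_reps_7_eq[of "n - 2"] num_reps_7(1)[of "int n"] assms by (auto simp: of_nat_diff)
  ultimately show ?thesis
    using num_reps_3_eq_UV[OF assms] by (simp add: U_def V_def)
qed

end
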